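(* Let $G$ be a periodic group which is not locally finite. (1) For every infinite set $A$, there exists a cellular automaton $\tau\colon A^G\to A^G$ whose image $\tau(A^G)$ is not closed in $A^G$ with respect to the prodiscrete topology. (2) For every field $K$ and every infinite-dimensional $K$-vector space $V$, there exists a linear cellular automaton $\tau\colon V^G\to V^G$ whose image $\tau(V^G)$ is not closed in $V^G$ with respect to the prodiscrete topology.
   Context: We work in ZFC. A group is periodic if all its elements have finite order; it is locally finite if every finitely generated subgroup of it is finite. For a group $G$ and a set $A$, $A^G$ is the set of all maps $G\to A$, with the prodiscrete topology: the product topology obtained by giving each factor $A$ the discrete topology. The group $G$ acts on $A^G$ by $(gx)(h)=x(g^{-1}h)$. A map $\tau\colon A^G\to A^G$ is a cellular automaton if there exist a finite subset $M\subset G$ (a memory set) and a map $\mu\colon A^M\to A$ (local defining map) such that $\tau(x)(g)=\mu((g^{-1}x)|_M)$ for all $x\in A^G$, $g\in G$; note $(g^{-1}x)(m)=x(gm)$. If $A=V$ is a vector space over a field $K$ and $\mu\colon V^M\to V$ can be taken $K$-linear, then $\tau$ is called a linear cellular automaton. *)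

theory Defs
  imports "HOL-Analysis.Function_Topology" "HOL-Algebra.Generated_Groups"
begin

definition periodic_group :: "('g, 'b) monoid_scheme \<Rightarrow> bool" where
  "periodic_group G \<longleftrightarrow>
     group G \<and> (\<forall>g\<in>carrier G. \<exists>n::nat. n > 0 \<and> g [^]\<^bsub>G\<^esub> n = \<one>\<^bsub>G\<^esub>)"

definition locally_finite_group :: "('g, 'b) monoid_scheme \<Rightarrow> bool" where
  "locally_finite_group G \<longleftrightarrow>
     group G \<and> (\<forall>S. finite S \<and> S \<subseteq> carrier G \<longrightarrow> finite (generate G S))"

text \<open>The set of maps from \<open>carrier G\<close> to \<open>A\<close>; as usual for \<open>\<rightarrow>\<^sub>E\<close>, a map is represented by the
  function that is \<open>undefined\<close> outside its domain.\<close>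

definition configurations :: "('g, 'b) monoid_scheme \<Rightarrow> 'a set \<Rightarrow> ('g \<Rightarrow> 'a) set" where
  "configurations G A = carrier G \<rightarrow>\<^sub>E A"

definition prodiscrete_topology ::
    "('g, 'b) monoid_scheme \<Rightarrow> 'a set \<Rightarrow> ('g \<Rightarrow> 'a) topology" where
  "prodiscrete_topology G A = product_topology (\<lambda>_. discrete_topology A) (carrier G)"

definition shift :: "('g, 'b) monoid_scheme \<Rightarrow> 'g \<Rightarrow> ('g \<Rightarrow> 'a) \<Rightarrow> ('g \<Rightarrow> 'a)" where
  "shift G g x = (\<lambda>h\<in>carrier G. x (inv\<^bsub>G\<^esub> g \<otimes>\<^bsub>G\<^esub> h))"

definition has_local_rule ::
    "('g, 'b) monoid_scheme \<Rightarrow> 'a set \<Rightarrow> (('g \<Rightarrow> 'a) \<Rightarrow> ('g \<Rightarrow> 'a)) \<Rightarrow>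
     'g set \<Rightarrow> (('g \<Rightarrow> 'a) \<Rightarrow> 'a) \<Rightarrow> bool" where
  "has_local_rule G A \<tau> M \<mu> \<longleftrightarrow>
     finite M \<and> M \<subseteq> carrier G \<and> \<mu> \<in> (M \<rightarrow>\<^sub>E A) \<rightarrow> A \<and>
     (\<forall>x\<in>configurations G A. \<forall>g\<in>carrier G.
        \<tau> x g = \<mu> (restrict (shift G (inv\<^bsub>G\<^esub> g) x) M))"

definition cellular_automaton ::
    "('g, 'b) monoid_scheme \<Rightarrow> 'a set \<Rightarrow> (('g \<Rightarrow> 'a) \<Rightarrow> ('g \<Rightarrow> 'a)) \<Rightarrow> bool" where
  "cellular_automaton G A \<tau> \<longleftrightarrow>
     \<tau> \<in> configurations G A \<rightarrow> configurations G A \<and> (\<exists>M \<mu>. has_local_rule G A \<tau> M \<mu>)"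

text \<open>Linearity of a map \<open>V\<^sup>M \<rightarrow> V\<close>, where \<open>V\<close> is the vector space given by the type \<open>'v\<close> with scalar
  multiplication \<open>smul\<close>. The operations on \<open>V\<^sup>M\<close> are pointwise on \<open>M\<close>; the restriction keeps
  the results \<open>undefined\<close> outside \<open>M\<close>, so that they lie in \<open>M \<rightarrow>\<^sub>E UNIV\<close>.\<close>

definition linear_local_map ::
    "('k::field \<Rightarrow> 'v::ab_group_add \<Rightarrow> 'v) \<Rightarrow> 'g set \<Rightarrow> (('g \<Rightarrow> 'v) \<Rightarrow> 'v) \<Rightarrow> bool" where
  "linear_local_map smul M \<mu> \<longleftrightarrow>
     (\<forall>x\<in>M \<rightarrow>\<^sub>E UNIV. \<forall>y\<in>M \<rightarrow>\<^sub>E UNIV. \<mu> (\<lambda>m\<in>M. x m + y m) = \<mu> x + \<mu> y) \<and>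
     (\<forall>c. \<forall>x\<in>M \<rightarrow>\<^sub>E UNIV. \<mu> (\<lambda>m\<in>M. smul c (x m)) = smul c (\<mu> x))"

definition linear_cellular_automaton ::
    "('g, 'b) monoid_scheme \<Rightarrow> ('k::field \<Rightarrow> 'v::ab_group_add \<Rightarrow> 'v) \<Rightarrow>
     (('g \<Rightarrow> 'v) \<Rightarrow> ('g \<Rightarrow> 'v)) \<Rightarrow> bool" where
  "linear_cellular_automaton G smul \<tau> \<longleftrightarrow>
     \<tau> \<in> configurations G UNIV \<rightarrow> configurations G UNIV \<and>
     (\<exists>M \<mu>. has_local_rule G UNIV \<tau> M \<mu> \<and> linear_local_map smul M \<mu>)"

definition infinite_dimensional ::
    "('k::field \<Rightarrow> 'v::ab_group_add \<Rightarrow> 'v) \<Rightarrow> bool" where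
  "infinite_dimensional smul \<longleftrightarrow>
     vector_space smul \<and> (\<nexists>B. finite_dimensional_vector_space smul B)"

end

theory Submission
  imports Defs
begin

text \<open>A group that is not locally finite contains an infinite subgroup \<open>H\<close> generated by a finite
  symmetric set \<open>T\<close>. Suppose that each \<open>g\<close> carries a set \<open>Q g\<close> containing \<open>\<one>\<close> and that
  \<open>s \<cdot> Q (g s) \<subseteq> Q g\<close> for all \<open>s \<in> T\<close>. Then \<open>H \<subseteq> Q g\<close>, so that \<open>Q g\<close> is infinite. On the other
  hand, for a finite set \<open>F\<close> the finite sets \<open>Q g = {h \<in> H. g h \<in> F}\<close> satisfy the second condition
  everywhere and the first one on \<open>F\<close>. An infinite alphabet can encode finite subsets of \<open>H\<close>, and an
  infinite-dimensional space their indicator functions in \<open>K\<^sup>(\<^sup>H\<^sup>)\<close>. The conditions are then tested by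
  a (linear) cellular automaton, and the constant configuration reporting that all tests succeed
  lies in the closure of its image but not in the image.\<close>

section \<open>Closure in the prodiscrete topology and automata given by local rules\<close>

text \<open>A basic neighbourhood of \<open>y\<close> constrains only finitely many coordinates, so
  points of \<open>Z\<close> matching \<open>y\<close> on arbitrary finite sets put \<open>y\<close>
  into the closure of \<open>Z\<close>.\<close>

lemma not_closedin_prodiscreteI:
  assumes y: "y \<in> configurations G A" "y \<notin> Z"
    and approx: "\<And>F. finite F \<Longrightarrow> F \<subseteq> carrier G \<Longrightarrow>
      \<exists>z\<in>Z. z \<in> configurations G A \<and> (\<forall>g\<in>F. z g = y g)"
  shows "\<not> closedin (prodiscrete_topology G A) Z"
proof
  assume "closedin (prodiscrete_topology G A) Z"
  then have "openin (prodiscrete_topology G A) (configurations G A - Z)"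
    by (simp add: closedin_def prodiscrete_topology_def configurations_def)
  moreover have "y \<in> configurations G A - Z" using y by blast
  ultimately obtain U where "finite {i \<in> carrier G. U i \<noteq> topspace (discrete_topology A)}"
      and U: "y \<in> Pi\<^sub>E (carrier G) U" "Pi\<^sub>E (carrier G) U \<subseteq> configurations G A - Z"
    unfolding prodiscrete_topology_def openin_product_topology_alt by meson
  then have fin: "finite {i \<in> carrier G. U i \<noteq> A}" by simp
  obtain z where z: "z \<in> Z" "z \<in> configurations G A" "\<forall>g\<in>{i \<in> carrier G. U i \<noteq> A}. z g = y g"
    using approx[OF fin] by auto
  have "z \<in> Pi\<^sub>E (carrier G) U"
  proof (rule PiE_I)
    fix g assume g: "g \<in> carrier G"
    show "z g \<in> U g"
    proof (cases "U g = A")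
      case True
      then show ?thesis using g z(2) by (auto simp: configurations_def)
    next
      case False
      then have "z g = y g" using g z(3) by auto
      then show ?thesis using g U(1) by auto
    qed
  next
    fix g assume "g \<notin> carrier G"
    then show "z g = undefined" using z(2) by (auto simp: configurations_def)
  qed
  with U(2) z(1) show False by blast
qed

text \<open>The shift in \<open>has_local_rule\<close> is already evaluated here: \<open>x\<close>
  shifted by the inverse of \<open>g\<close> has the value \<open>x (g \<otimes> m)\<close> at
  \<open>m\<close>.\<close>

definition automaton_of ::
    "('g, 'b) monoid_scheme \<Rightarrow> 'g set \<Rightarrow> (('g \<Rightarrow> 'a) \<Rightarrow> 'a) \<Rightarrow> ('g \<Rightarrow> 'a) \<Rightarrow> ('g \<Rightarrow> 'a)" where
  "automaton_of G M \<mu> x = (\<lambda>g\<in>carrier G. \<mu> (\<lambda>m\<in>M. x (g \<otimes>\<^bsub>G\<^esub> m)))"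

lemma (in group) automaton_of_configurations:
  assumes "M \<subseteq> carrier G" "\<mu> \<in> (M \<rightarrow>\<^sub>E A) \<rightarrow> A"
  shows "automaton_of G M \<mu> \<in> configurations G A \<rightarrow> configurations G A"
proof
  fix x assume "x \<in> configurations G A"
  then have "(\<lambda>m\<in>M. x (g \<otimes> m)) \<in> M \<rightarrow>\<^sub>E A" if "g \<in> carrier G" for g
    using that assms(1) by (auto simp: configurations_def)
  then have "\<mu> (\<lambda>m\<in>M. x (g \<otimes> m)) \<in> A" if "g \<in> carrier G" for g
    using that assms(2) by blast
  then show "automaton_of G M \<mu> x \<in> configurations G A"
    by (simp add: automaton_of_def configurations_def)
qed

lemma (in group) has_local_rule_automaton_of:
  fixes A :: "'c set"
  assumes "finite M" "M \<subseteq> carrier G" "\<mu> \<in> (M \<rightarrow>\<^sub>E A) \<rightarrow> A"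
  shows "has_local_rule G A (automaton_of G M \<mu>) M \<mu>"
proof -
  have "restrict (shift G (inv g) x) M = (\<lambda>m\<in>M. x (g \<otimes> m))"
    if "g \<in> carrier G" for g and x :: "'a \<Rightarrow> 'c"
    using that assms(2) by (auto simp: shift_def restrict_def fun_eq_iff)
  then show ?thesis
    using assms by (simp add: has_local_rule_def automaton_of_def)
qed

section \<open>Finitely generated subgroups\<close>

text \<open>Adjoining \<open>\<one>\<close> and inverses can only enlarge the generated subgroup.
  With \<open>\<one> \<in> T\<close>, a rule with memory \<open>T\<close> can read the cell itself;
  with inverses in \<open>T\<close>, every element of \<open>generate G T\<close> is reached by
  steps from \<open>T\<close> alone.\<close>

lemma (in group) infinite_symmetric_generation:
  assumes "\<not> locally_finite_group G"
  obtains T where "finite T" "T \<subseteq> carrier G" "\<one> \<in> T" "\<And>s. s \<in> T \<Longrightarrow> inv s \<in> T"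
    "infinite (generate G T)"
proof -
  obtain S where S: "finite S" "S \<subseteq> carrier G" "infinite (generate G S)"
    using assms is_group by (auto simp: locally_finite_group_def)
  let ?T = "insert \<one> (S \<union> m_inv G ` S)"
  have "generate G S \<subseteq> generate G ?T"
    by (rule mono_generate) auto
  then have "infinite (generate G ?T)"
    using S(3) finite_subset by blast
  moreover have "\<And>s. s \<in> ?T \<Longrightarrow> inv s \<in> ?T"
    using S(2) by auto
  ultimately show ?thesis
    using S by (intro that[of ?T]) auto
qed

text \<open>Every element is the product of a word over \<open>T\<close> and its inverses, and there
  are only countably many such words.\<close>

lemma (in group) countable_generate:
  assumes "countable T" "T \<subseteq> carrier G"
  shows "countable (generate G T)"
proof -
  let ?W = "(\<lambda>w. foldr (\<otimes>) w \<one>) ` lists (T \<union> m_inv G ` T)"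
  have closed: "foldr (\<otimes>) w \<one> \<in> carrier G" if "set w \<subseteq> T \<union> m_inv G ` T" for w
    using that assms(2) by (induction w) auto
  have app: "foldr (\<otimes>) (v @ w) \<one> = foldr (\<otimes>) v \<one> \<otimes> foldr (\<otimes>) w \<one>"
    if "set v \<subseteq> T \<union> m_inv G ` T" "set w \<subseteq> T \<union> m_inv G ` T" for v w
    using that(1)
  proof (induction v)
    case Nil
    then show ?case using closed[OF that(2)] by simp
  next
    case (Cons a v)
    have "a \<in> carrier G" using Cons.prems assms(2) by auto
    then show ?case using Cons closed[of v] closed[OF that(2)] by (simp add: m_assoc)
  qed
  have "h \<in> ?W" if "h \<in> generate G T" for h
    using that
  proof induction
    case one
    show ?case by (rule image_eqI[of _ _ "[]"]) auto
  next
    case (incl h)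
    then show ?case using assms(2) by (intro image_eqI[of _ _ "[h]"]) auto
  next
    case (inv h)
    then show ?case using assms(2) by (intro image_eqI[of _ _ "[inv h]"]) auto
  next
    case (eng h1 h2)
    then obtain v w where "set v \<subseteq> T \<union> m_inv G ` T" "set w \<subseteq> T \<union> m_inv G ` T"
        "h1 = foldr (\<otimes>) v \<one>" "h2 = foldr (\<otimes>) w \<one>"
      by (auto simp: lists_eq_set)
    then show ?case
      by (intro image_eqI[of _ _ "v @ w"]) (auto simp: app lists_eq_set simp del: foldr_append)
  qed
  then have "generate G T \<subseteq> ?W" by blast
  moreover have "countable ?W"
    using assms(1) by (intro countable_image countable_lists) auto
  ultimately show ?thesis by (rule countable_subset)
qed

lemma (in group) finite_translate_into:
  assumes "g \<in> carrier G" "H \<subseteq> carrier G" "finite F"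
  shows "finite {h \<in> H. g \<otimes> h \<in> F}"
proof (rule finite_imageD[of "\<lambda>h. g \<otimes> h"])
  show "finite ((\<lambda>h. g \<otimes> h) ` {h \<in> H. g \<otimes> h \<in> F})"
    by (rule finite_subset[OF _ assms(3)]) auto
  show "inj_on (\<lambda>h. g \<otimes> h) {h \<in> H. g \<otimes> h \<in> F}"
    using assms(1,2) by (intro inj_onI) (simp add: subset_iff)
qed

text \<open>Start from \<open>\<one> \<in> Q (g \<otimes> h)\<close> and walk back along a word for
  \<open>h\<close>: each step prepends a letter and moves the base point, until
  \<open>h \<in> Q g\<close> is reached. The walk visits other base points, so the hypotheses speak
  of all of them.\<close>

lemma (in group) generate_subset_propagated:
  assumes "T \<subseteq> carrier G" and inv_T: "\<And>s. s \<in> T \<Longrightarrow> inv s \<in> T"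
    and one: "\<And>g. g \<in> carrier G \<Longrightarrow> \<one> \<in> Q g"
    and step: "\<And>g s k. \<lbrakk>g \<in> carrier G; s \<in> T; k \<in> generate G T; k \<in> Q (g \<otimes> s)\<rbrakk> \<Longrightarrow> s \<otimes> k \<in> Q g"
    and "g \<in> carrier G"
  shows "generate G T \<subseteq> Q g"
proof
  \<comment> \<open>The extra factor \<open>k\<close> makes the product case work: \<open>h2\<close>
    is prepended at base point \<open>g \<otimes> h1\<close>, then \<open>h1\<close> at
    \<open>g\<close>.\<close>
  have *: "h \<otimes> k \<in> Q g" if "h \<in> generate G T" "g \<in> carrier G" "k \<in> generate G T" "k \<in> Q (g \<otimes> h)"
    for h k g
    using that
  proof (induction arbitrary: g k)
    case one
    then show ?case using generate_in_carrier[OF assms(1)] by simp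
  next
    case (incl h)
    then show ?case using step by blast
  next
    case (inv h)
    then show ?case using step inv_T by blast
  next
    case (eng h1 h2)
    note carr = generate_in_carrier[OF assms(1)]
    have "h2 \<otimes> k \<in> Q (g \<otimes> h1)"
      using eng carr by (simp add: m_assoc)
    then have "h1 \<otimes> (h2 \<otimes> k) \<in> Q g"
      using eng by (simp add: generate.eng)
    then show ?case using eng carr by (simp add: m_assoc)
  qed
  fix h assume h: "h \<in> generate G T"
  have hc: "h \<in> carrier G" using generate_in_carrier[OF assms(1) h] .
  have "h \<otimes> \<one> \<in> Q g"
    using *[OF h \<open>g \<in> carrier G\<close> generate.one] one assms(5) hc by simp
  then show "h \<in> Q g" using hc by simp
qed

section \<open>Infinite alphabets\<close>

text \<open>A sequence of distinct elements of \<open>A\<close> indexes an enumeration of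
  \<open>C\<close>. Any other argument gets an arbitrary index, whose value still lies in the
  nonempty \<open>C\<close>.\<close>

lemma infinite_encodes_countable:
  assumes "infinite A" "countable C" "C \<noteq> {}"
  shows "\<exists>\<phi>. (\<forall>a. \<phi> a \<in> C) \<and> C \<subseteq> \<phi> ` A"
proof -
  obtain f :: "nat \<Rightarrow> _" where f: "inj f" "range f \<subseteq> A"
    using assms(1) infinite_countable_subset by blast
  let ?\<phi> = "\<lambda>a. from_nat_into C (inv_into UNIV f a)"
  have "C \<subseteq> ?\<phi> ` A"
  proof
    fix c assume "c \<in> C"
    from from_nat_into_surj[OF assms(2) this] obtain n where "from_nat_into C n = c" ..
    then have "?\<phi> (f n) = c" using f(1) by simp
    then show "c \<in> ?\<phi> ` A" using f(2) by blast
  qed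
  then show ?thesis
    using from_nat_into[OF assms(3)] by (intro exI[of _ ?\<phi>]) simp
qed

lemma (in group) exists_automaton_image_not_closed:
  fixes A :: "'c set"
  assumes "\<not> locally_finite_group G" "infinite A"
  shows "\<exists>\<tau>. cellular_automaton G A \<tau> \<and>
    \<not> closedin (prodiscrete_topology G A) (\<tau> ` configurations G A)"
proof -
  obtain T where T: "finite T" "T \<subseteq> carrier G" "\<one> \<in> T" "\<And>s. s \<in> T \<Longrightarrow> inv s \<in> T"
      "infinite (generate G T)"
    using infinite_symmetric_generation[OF assms(1)] by blast
  define H where "H = generate G T"
  have H: "\<one> \<in> H" "\<And>s k. s \<in> T \<Longrightarrow> k \<in> H \<Longrightarrow> s \<otimes> k \<in> H" "H \<subseteq> carrier G"
    using generate_incl[OF T(2)] by (auto simp: H_def generate.one intro: generate.eng generate.incl)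
  \<comment> \<open>\<open>H\<close> is countable because \<open>T\<close> is finite, so
    \<open>A\<close> can encode all finite subsets of \<open>H\<close> whatever its
    cardinality.\<close>
  have "countable {X. finite X \<and> X \<subseteq> H}" (is "countable ?C")
    unfolding H_def
    by (intro countable_Collect_finite_subset countable_generate countable_finite T)
  moreover have "?C \<noteq> {}" by blast
  ultimately obtain \<phi> where "(\<forall>a. \<phi> a \<in> ?C) \<and> ?C \<subseteq> \<phi> ` A"
    using infinite_encodes_countable[OF assms(2)] by meson
  then have \<phi>: "finite (\<phi> a)" "finite X \<Longrightarrow> X \<subseteq> H \<Longrightarrow> \<exists>a\<in>A. \<phi> a = X" for a X
    by blast+
  \<comment> \<open>\<open>a\<close> will report that the test at a cell succeeds, \<open>b\<close>
    that it fails.\<close>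
  obtain a b where ab: "a \<in> A" "b \<in> A" "a \<noteq> b"
    using infinite_arbitrarily_large[OF assms(2), of 2] by (auto simp: card_2_iff)
  \<comment> \<open>When the rule is applied at \<open>g\<close>, \<open>u \<one>\<close> is the
    symbol at \<open>g\<close> and \<open>u s\<close> the one at
    \<open>g \<otimes> s\<close>.\<close>
  define ok where "ok u \<longleftrightarrow> \<one> \<in> \<phi> (u \<one>) \<and> (\<forall>s\<in>T. \<forall>k\<in>\<phi> (u s). s \<otimes> k \<in> \<phi> (u \<one>))" for u
  define \<mu> where "\<mu> u = (if ok u then a else b)" for u
  let ?\<tau> = "automaton_of G T \<mu>"
  let ?y = "\<lambda>g\<in>carrier G. a"
  have \<mu>: "\<mu> \<in> (T \<rightarrow>\<^sub>E A) \<rightarrow> A" using ab by (auto simp: \<mu>_def)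
  have \<tau>_eq: "?\<tau> x g = a \<longleftrightarrow> ok (\<lambda>m\<in>T. x (g \<otimes> m))" if "g \<in> carrier G" for x g
    using that ab by (simp add: automaton_of_def \<mu>_def)
  have "cellular_automaton G A ?\<tau>"
    using automaton_of_configurations[OF T(2) \<mu>] has_local_rule_automaton_of[OF T(1,2) \<mu>]
    by (auto simp: cellular_automaton_def)
  moreover have "\<not> closedin (prodiscrete_topology G A) (?\<tau> ` configurations G A)"
  proof (rule not_closedin_prodiscreteI)
    show "?y \<in> configurations G A" using ab by (auto simp: configurations_def)
    show "?y \<notin> ?\<tau> ` configurations G A"
    proof
      assume "?y \<in> ?\<tau> ` configurations G A"
      then obtain x where "?y = ?\<tau> x" by blast
      then have "?\<tau> x g = a" if "g \<in> carrier G" for g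
        using that by (metis restrict_apply')
      then have ok: "ok (\<lambda>m\<in>T. x (g \<otimes> m))" if "g \<in> carrier G" for g
        using that \<tau>_eq by blast
      \<comment> \<open>Success of \<open>ok\<close> at every cell supplies both hypotheses of the
        propagation lemma, which traps an infinite subgroup in a finite set.\<close>
      have "generate G T \<subseteq> \<phi> (x \<one>)"
      proof (rule generate_subset_propagated[OF T(2,4), where Q = "\<lambda>g. \<phi> (x g)"])
        show "\<one> \<in> \<phi> (x g)" if "g \<in> carrier G" for g
          using ok[OF that] that T(3) by (simp add: ok_def)
        show "s \<otimes> k \<in> \<phi> (x g)" if "g \<in> carrier G" "s \<in> T" "k \<in> \<phi> (x (g \<otimes> s))" for g s k
          using ok[OF that(1)] that T(3) by (simp add: ok_def)
      qed auto
      then show False using T(5) \<phi>(1) finite_subset by blast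
    qed
    fix F assume F: "finite F" "F \<subseteq> carrier G"
    define Q where "Q g = {h \<in> H. g \<otimes> h \<in> F}" for g
    have "finite (Q g)" if "g \<in> carrier G" for g
      unfolding Q_def using that H(3) F(1) by (rule finite_translate_into)
    then have "\<forall>g\<in>carrier G. \<exists>d\<in>A. \<phi> d = Q g"
      using \<phi>(2) by (simp add: Q_def)
    then obtain x0 where x0: "\<And>g. g \<in> carrier G \<Longrightarrow> x0 g \<in> A \<and> \<phi> (x0 g) = Q g"
      by metis
    define x where "x = restrict x0 (carrier G)"
    have x: "x \<in> configurations G A" using x0 by (auto simp: x_def configurations_def)
    have \<phi>x: "\<phi> (x g) = Q g" if "g \<in> carrier G" for g using x0 that by (simp add: x_def)
    have "ok (\<lambda>m\<in>T. x (g \<otimes> m))" if g: "g \<in> F" for g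
    proof -
      have gc: "g \<in> carrier G" using g F by auto
      \<comment> \<open>By associativity both memberships place the same element in
        \<open>F\<close>. The condition \<open>\<one> \<in> Q g\<close> below is where
        \<open>g \<in> F\<close> itself enters.\<close>
      have "s \<otimes> k \<in> Q g" if "s \<in> T" "k \<in> Q (g \<otimes> s)" for s k
      proof -
        have "k \<in> H" using that by (simp add: Q_def)
        then show ?thesis
          using that H T(2) gc by (auto simp: Q_def m_assoc subset_iff)
      qed
      moreover have "\<one> \<in> Q g" using g gc H(1) by (simp add: Q_def)
      ultimately show ?thesis
        using gc T(2,3) \<phi>x by (simp add: ok_def subset_iff)
    qed
    then show "\<exists>z\<in>?\<tau> ` configurations G A. z \<in> configurations G A \<and> (\<forall>g\<in>F. z g = ?y g)"
      using x F(2) automaton_of_configurations[OF T(2) \<mu>] \<tau>_eq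
      by (intro bexI[of _ "?\<tau> x"]) (auto simp: subset_iff)
  qed
  ultimately show ?thesis by blast
qed

section \<open>Infinite-dimensional spaces\<close>

text \<open>One vector stores a finitely supported family over \<open>I\<close>: \<open>comb\<close>
  embeds such families linearly, and \<open>coord\<close> is a linear left inverse. Since
  \<open>comb\<close> is total, its linearity and the inverse law are restricted to finite support
  on \<open>I\<close>.\<close>

locale coordinate_system =
  fixes smul :: "'k::field \<Rightarrow> 'v::ab_group_add \<Rightarrow> 'v"
    and I :: "'i set" and coord :: "'i \<Rightarrow> 'v \<Rightarrow> 'k" and comb :: "('i \<Rightarrow> 'k) \<Rightarrow> 'v"
  assumes coord_add: "coord i (u + v) = coord i u + coord i v"
    and coord_scale: "coord i (smul r v) = r * coord i v"
    and finite_coord: "finite {i. coord i v \<noteq> 0}"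
    and coord_comb: "\<lbrakk>finite {i\<in>I. a i \<noteq> 0}; i \<in> I\<rbrakk> \<Longrightarrow> coord i (comb a) = a i"
    and comb_add: "\<lbrakk>finite {i\<in>I. a i \<noteq> 0}; finite {i\<in>I. b i \<noteq> 0}\<rbrakk> \<Longrightarrow>
      comb (\<lambda>i. a i + b i) = comb a + comb b"
    and comb_scale: "finite {i\<in>I. a i \<noteq> 0} \<Longrightarrow> comb (\<lambda>i. r * a i) = smul r (comb a)"
    and comb_cong: "(\<And>i. i \<in> I \<Longrightarrow> a i = b i) \<Longrightarrow> comb a = comb b"

text \<open>An infinite basis contains a sequence of distinct vectors, which a countable
  \<open>I\<close> can index; coordinates are then basis coefficients.\<close>

lemma infinite_dimensional_coordinates:
  fixes smul :: "'k::field \<Rightarrow> 'v::ab_group_add \<Rightarrow> 'v"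
    and I :: "'i set"
  assumes "infinite_dimensional smul" "countable I"
  shows "\<exists>c E. coordinate_system smul I c E"
proof -
  interpret vector_space smul
    using assms(1) by (simp add: infinite_dimensional_def)
  obtain B where B: "independent B" "span B = UNIV"
    using independent_extend_basis[OF independent_empty] span_extend_basis[OF independent_empty]
    by blast
  have "infinite B"
    using assms(1) B vector_space_axioms
    by (auto simp: infinite_dimensional_def finite_dimensional_vector_space_def
        finite_dimensional_vector_space_axioms_def)
  then obtain f :: "nat \<Rightarrow> 'v" where f: "inj f" "range f \<subseteq> B"
    using infinite_countable_subset by blast
  define j where "j i = f (to_nat_on I i)" for i
  have j: "inj_on j I" "j ` I \<subseteq> B"
    using f inj_on_to_nat_on[OF assms(2)] by (auto simp: j_def inj_on_def)
  \<comment> \<open>The default 0 outside \<open>I\<close> keeps the set of nonzero coordinates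
    finite, since \<open>j\<close> is known to be injective only on \<open>I\<close>.\<close>
  define c where "c i v = (if i \<in> I then representation B v (j i) else 0)" for i v
  define E where "E a = (\<Sum>i | i \<in> I \<and> a i \<noteq> 0. smul (a i) (j i))" for a
  \<comment> \<open>This allows two families to be summed over the union of their supports.\<close>
  have E_eq: "E a = (\<Sum>i\<in>J. smul (a i) (j i))" if "finite J" "J \<subseteq> I" "{i\<in>I. a i \<noteq> 0} \<subseteq> J" for a J
    unfolding E_def using that by (intro sum.mono_neutral_left) auto
  have c_sum: "c i (\<Sum>n\<in>J. g n) = (\<Sum>n\<in>J. c i (g n))" for i and g :: "'i \<Rightarrow> 'v" and J
    by (simp add: c_def representation_sum B)
  have c_scale: "c i (smul r v) = r * c i v" for i r v
    by (simp add: c_def representation_scale B)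
  have "coordinate_system smul I c E"
  proof
    show "c i (u + v) = c i u + c i v" for i u v
      by (simp add: c_def representation_add B)
    show "c i (smul r v) = r * c i v" for i r v
      by (rule c_scale)
    show "finite {i. c i v \<noteq> 0}" for v
    proof (rule finite_imageD[of j])
      show "finite (j ` {i. c i v \<noteq> 0})"
        by (rule finite_subset[OF _ finite_representation[of B v]]) (auto simp: c_def)
      show "inj_on j {i. c i v \<noteq> 0}"
        using j(1) by (rule inj_on_subset) (auto simp: c_def)
    qed
    show "c i (E a) = a i" if "finite {i\<in>I. a i \<noteq> 0}" "i \<in> I" for a i
    proof -
      have c_j: "c i (j n) = (if n = i then 1 else 0)" if "n \<in> I" for n
        using that \<open>i \<in> I\<close> j B(1) by (auto simp: c_def representation_basis inj_on_eq_iff)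
      have "c i (E a) = (\<Sum>n | n \<in> I \<and> a n \<noteq> 0. a n * c i (j n))"
        by (simp add: E_def c_sum c_scale)
      also have "\<dots> = (\<Sum>n | n \<in> I \<and> a n \<noteq> 0. if n = i then a n else 0)"
        by (intro sum.cong) (auto simp: c_j)
      also have "\<dots> = a i"
        using that by (simp add: sum.delta)
      finally show ?thesis .
    qed
    show "E (\<lambda>i. a i + b i) = E a + E b"
      if "finite {i\<in>I. a i \<noteq> 0}" "finite {i\<in>I. b i \<noteq> 0}" for a b
    proof -
      let ?J = "{i\<in>I. a i \<noteq> 0} \<union> {i\<in>I. b i \<noteq> 0}"
      have "E (\<lambda>i. a i + b i) = (\<Sum>i\<in>?J. smul (a i + b i) (j i))"
        using that by (intro E_eq) auto
      also have "\<dots> = (\<Sum>i\<in>?J. smul (a i) (j i)) + (\<Sum>i\<in>?J. smul (b i) (j i))"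
        by (simp add: scale_left_distrib sum.distrib)
      also have "\<dots> = E a + E b"
        using that by (intro arg_cong2[of _ _ _ _ "(+)"] E_eq[symmetric]) auto
      finally show ?thesis .
    qed
    show "E (\<lambda>i. r * a i) = smul r (E a)" if "finite {i\<in>I. a i \<noteq> 0}" for a r
    proof -
      have "E (\<lambda>i. r * a i) = (\<Sum>i\<in>{i\<in>I. a i \<noteq> 0}. smul (r * a i) (j i))"
        using that by (intro E_eq) auto
      then show ?thesis by (simp add: E_def scale_sum_right)
    qed
    show "E a = E b" if "\<And>i. i \<in> I \<Longrightarrow> a i = b i" for a b
      unfolding E_def using that by (intro sum.cong) auto
  qed
  then show ?thesis by blast
qed

text \<open>A linear rule cannot choose a verdict by cases, so it outputs the results of all
  comparisons, packed into one vector. The affine requirement that coordinate \<open>\<one>\<close>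
  be 1 moves into the target configuration.\<close>

lemma (in group) exists_linear_automaton_image_not_closed:
  fixes smul :: "'k::field \<Rightarrow> 'v::ab_group_add \<Rightarrow> 'v"
  assumes "\<not> locally_finite_group G" "infinite_dimensional smul"
  shows "\<exists>\<tau>. linear_cellular_automaton G smul \<tau> \<and>
    \<not> closedin (prodiscrete_topology G (UNIV :: 'v set)) (\<tau> ` configurations G (UNIV :: 'v set))"
proof -
  obtain T where T: "finite T" "T \<subseteq> carrier G" "\<one> \<in> T" "\<And>s. s \<in> T \<Longrightarrow> inv s \<in> T"
      "infinite (generate G T)"
    using infinite_symmetric_generation[OF assms(1)] by blast
  define H where "H = generate G T"
  have H: "\<one> \<in> H" "\<And>s k. s \<in> T \<Longrightarrow> k \<in> H \<Longrightarrow> s \<otimes> k \<in> H" "H \<subseteq> carrier G"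
    using generate_incl[OF T(2)] by (auto simp: H_def generate.one intro: generate.eng generate.incl)
  have cH: "countable H"
    unfolding H_def by (intro countable_generate countable_finite T)
  obtain c and E :: "('a \<Rightarrow> 'k) \<Rightarrow> 'v" where "coordinate_system smul H c E"
    using infinite_dimensional_coordinates[OF assms(2) cH] by blast
  then interpret C: coordinate_system smul H c E .
  \<comment> \<open>The comparisons are indexed by \<open>T \<times> H\<close>; a second coordinate
    system packs their results into the output vector.\<close>
  have "countable (T \<times> H)"
    using cH T(1) by (simp add: countable_finite)
  then obtain d and D :: "('a \<times> 'a \<Rightarrow> 'k) \<Rightarrow> 'v" where "coordinate_system smul (T \<times> H) d D"
    using infinite_dimensional_coordinates[OF assms(2)] by blast
  then interpret D: coordinate_system smul "T \<times> H" d D .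
  \<comment> \<open>\<open>p\<close> compares coordinate \<open>s k\<close> at \<open>g\<close> with coordinate \<open>k\<close> at \<open>g s\<close>; for \<open>s k = \<one>\<close> it reports
    coordinate \<open>\<one>\<close> at \<open>g\<close> instead. So \<open>p = q\<close> says that all comparisons succeed and that
    coordinate \<open>\<one>\<close> is \<open>1\<close>.\<close>
  define p where "p u i = (case i of (s, k) \<Rightarrow>
      c (s \<otimes> k) (u \<one>) - (if s \<otimes> k = \<one> then 0 else c k (u s)))" for u :: "'a \<Rightarrow> 'v" and i
  define q :: "'a \<times> 'a \<Rightarrow> 'k" where "q i = (case i of (s, k) \<Rightarrow> if s \<otimes> k = \<one> then 1 else 0)" for i
  \<comment> \<open>For each of the finitely many \<open>s\<close>, a nonzero entry forces
    \<open>s \<otimes> k\<close> into the support of \<open>u \<one>\<close> or \<open>k\<close>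
    into that of \<open>u s\<close>.\<close>
  have fin_p: "finite {i\<in>T \<times> H. p u i \<noteq> 0}" for u
  proof (rule finite_subset)
    show "{i\<in>T \<times> H. p u i \<noteq> 0} \<subseteq> (\<Union>s\<in>T. (\<lambda>k. (s, k)) `
        ((\<lambda>h. inv s \<otimes> h) ` {h. c h (u \<one>) \<noteq> 0} \<union> {k. c k (u s) \<noteq> 0}))"
    proof clarify
      fix s k assume *: "s \<in> T" "k \<in> H" "p u (s, k) \<noteq> 0"
      then have "k = inv s \<otimes> (s \<otimes> k)"
        using T(2) H(3) by (simp add: m_assoc[symmetric] subset_iff)
      moreover have "c (s \<otimes> k) (u \<one>) \<noteq> 0 \<or> c k (u s) \<noteq> 0"
        using *(3) by (auto simp: p_def split: if_splits)
      ultimately show "(s, k) \<in> (\<Union>s\<in>T. (\<lambda>k. (s, k)) `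
          ((\<lambda>h. inv s \<otimes> h) ` {h. c h (u \<one>) \<noteq> 0} \<union> {k. c k (u s) \<noteq> 0}))"
        using *(1) by blast
    qed
    show "finite (\<Union>s\<in>T. (\<lambda>k. (s, k)) `
        ((\<lambda>h. inv s \<otimes> h) ` {h. c h (u \<one>) \<noteq> 0} \<union> {k. c k (u s) \<noteq> 0}))"
      using T(1) C.finite_coord by blast
  qed
  have fin_q: "finite {i\<in>T \<times> H. q i \<noteq> 0}"
  proof (rule finite_subset)
    show "{i\<in>T \<times> H. q i \<noteq> 0} \<subseteq> (\<lambda>s. (s, inv s)) ` T"
    proof clarify
      fix s k assume *: "s \<in> T" "k \<in> H" "q (s, k) \<noteq> 0"
      then have "s \<otimes> k = \<one>" by (auto simp: q_def split: if_splits)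
      then have "k = inv s" using * T(2) H(3) by (metis inv_equality inv_inv subsetD)
      then show "(s, k) \<in> (\<lambda>s. (s, inv s)) ` T" using *(1) by blast
    qed
  qed (use T(1) in simp)
  define \<mu> where "\<mu> u = D (p u)" for u
  let ?\<tau> = "automaton_of G T \<mu>"
  let ?y = "\<lambda>g\<in>carrier G. D q"
  have \<mu>: "\<mu> \<in> (T \<rightarrow>\<^sub>E UNIV) \<rightarrow> UNIV" by simp
  have \<tau>_eq: "?\<tau> x g = D (p (\<lambda>m\<in>T. x (g \<otimes> m)))" if "g \<in> carrier G" for x g
    using that by (simp add: automaton_of_def \<mu>_def)
  have "linear_local_map smul T \<mu>"
    unfolding linear_local_map_def
  proof (intro conjI ballI allI)
    fix x y :: "'a \<Rightarrow> 'v"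
    \<comment> \<open>For \<open>s\<close> outside \<open>T\<close> the restricted sum is
      \<open>undefined\<close> at \<open>s\<close>, so the families are compared on
      \<open>T \<times> H\<close> only.\<close>
    have "\<mu> (\<lambda>m\<in>T. x m + y m) = D (\<lambda>i. p x i + p y i)"
      unfolding \<mu>_def using T(3) by (intro D.comb_cong) (auto simp: p_def C.coord_add)
    then show "\<mu> (\<lambda>m\<in>T. x m + y m) = \<mu> x + \<mu> y"
      by (simp add: \<mu>_def D.comb_add D.comb_scale fin_p)
  next
    fix r and x :: "'a \<Rightarrow> 'v"
    have "\<mu> (\<lambda>m\<in>T. smul r (x m)) = D (\<lambda>i. r * p x i)"
      unfolding \<mu>_def using T(3) by (intro D.comb_cong) (auto simp: p_def C.coord_scale algebra_simps)
    then show "\<mu> (\<lambda>m\<in>T. smul r (x m)) = smul r (\<mu> x)"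
      by (simp add: \<mu>_def D.comb_add D.comb_scale fin_p)
  qed
  then have "linear_cellular_automaton G smul ?\<tau>"
    using automaton_of_configurations[OF T(2) \<mu>] has_local_rule_automaton_of[OF T(1,2) \<mu>]
    by (auto simp: linear_cellular_automaton_def)
  moreover have "\<not> closedin (prodiscrete_topology G (UNIV :: 'v set))
      (?\<tau> ` configurations G (UNIV :: 'v set))"
  proof (rule not_closedin_prodiscreteI)
    show "?y \<in> configurations G UNIV" by (auto simp: configurations_def)
    show "?y \<notin> ?\<tau> ` configurations G UNIV"
    proof
      assume "?y \<in> ?\<tau> ` configurations G UNIV"
      then obtain x where "?y = ?\<tau> x" by blast
      then have "?\<tau> x g = D q" if "g \<in> carrier G" for g
        using that by (metis restrict_apply')
      \<comment> \<open>Applying the coordinates \<open>d\<close> to both packed vectors recovers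
        the individual entries.\<close>
      then have pq: "p (\<lambda>m\<in>T. x (g \<otimes> m)) (s, k) = q (s, k)"
        if "g \<in> carrier G" "s \<in> T" "k \<in> H" for g s k
        using that \<tau>_eq D.coord_comb[OF fin_p] D.coord_comb[OF fin_q] by (metis SigmaI)
      \<comment> \<open>This is the entry at \<open>(\<one>, \<one>)\<close>, which reports
        coordinate \<open>\<one>\<close> itself.\<close>
      have one: "c \<one> (x g) = 1" if "g \<in> carrier G" for g
        using pq[OF that T(3) H(1)] that T(3) by (simp add: p_def q_def)
      have "generate G T \<subseteq> {h. c h (x \<one>) = 1}"
      proof (rule generate_subset_propagated[OF T(2,4), where Q = "\<lambda>g. {h. c h (x g) = 1}"])
        \<comment> \<open>If \<open>s \<otimes> k = \<one>\<close>, then \<open>one\<close> applies;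
          otherwise the vanishing entry equates the two coordinates.\<close>
        show "s \<otimes> k \<in> {h. c h (x g) = 1}"
          if "g \<in> carrier G" "s \<in> T" "k \<in> generate G T" "k \<in> {h. c h (x (g \<otimes> s)) = 1}" for g s k
          using pq[of g s k] that T(3) one by (auto simp: p_def q_def H_def split: if_splits)
      qed (use one in auto)
      then have "generate G T \<subseteq> {h. c h (x \<one>) \<noteq> 0}" by auto
      then show False using T(5) C.finite_coord finite_subset by blast
    qed
    fix F assume F: "finite F" "F \<subseteq> carrier G"
    \<comment> \<open>The value at \<open>g\<close> encodes the indicator function of the elements
      of \<open>H\<close> that translation by \<open>g\<close> takes into \<open>F\<close>.\<close>
    define x where "x = (\<lambda>g\<in>carrier G. E (\<lambda>h. if g \<otimes> h \<in> F then 1 else 0))"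
    have x: "x \<in> configurations G UNIV" by (auto simp: x_def configurations_def)
    have cx: "c h (x g) = (if g \<otimes> h \<in> F then 1 else 0)" if "g \<in> carrier G" "h \<in> H" for g h
    proof -
      have "finite {h \<in> H. g \<otimes> h \<in> F}"
        using that(1) H(3) F(1) by (rule finite_translate_into)
      then have "finite {h \<in> H. (if g \<otimes> h \<in> F then 1 else 0 :: 'k) \<noteq> 0}"
        by (rule rev_finite_subset) auto
      from C.coord_comb[OF this that(2)] show ?thesis using that(1) by (simp add: x_def)
    qed
    have "?\<tau> x g = D q" if g: "g \<in> F" for g
    proof -
      have gc: "g \<in> carrier G" using g F by auto
      have "p (\<lambda>m\<in>T. x (g \<otimes> m)) (s, k) = q (s, k)" if "s \<in> T" "k \<in> H" for s k
      proof -
        have sk: "s \<in> carrier G" "k \<in> carrier G" using that T(2) H(3) by auto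
        \<comment> \<open>The two coordinates agree, so their difference vanishes; for
          \<open>s \<otimes> k = \<one>\<close> the reported coordinate is 1 because
          \<open>g \<in> F\<close>.\<close>
        have "c (s \<otimes> k) (x g) = (if g \<otimes> (s \<otimes> k) \<in> F then 1 else 0)"
          using cx[OF gc] H(2)[OF that] by simp
        moreover have "c k (x (g \<otimes> s)) = (if g \<otimes> (s \<otimes> k) \<in> F then 1 else 0)"
          using cx[of "g \<otimes> s" k] that gc sk by (simp add: m_assoc)
        ultimately show ?thesis
          using that(1) T(3) gc g by (auto simp: p_def q_def)
      qed
      then have "D (p (\<lambda>m\<in>T. x (g \<otimes> m))) = D q"
        by (intro D.comb_cong) auto
      then show ?thesis by (simp add: \<tau>_eq gc)
    qed
    then show "\<exists>z\<in>?\<tau> ` configurations G UNIV. z \<in> configurations G UNIV \<and> (\<forall>g\<in>F. z g = ?y g)"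
      using x F(2) automaton_of_configurations[OF T(2) \<mu>]
      by (intro bexI[of _ "?\<tau> x"]) (auto simp: subset_iff)
  qed
  ultimately show ?thesis by blast
qed

theorem corollary1p4:
  fixes G :: "('g, 'b) monoid_scheme"
  assumes "group G" and "periodic_group G" and "\<not> locally_finite_group G"
  shows "(\<forall>A :: 'a set. infinite A \<longrightarrow>
            (\<exists>\<tau>. cellular_automaton G A \<tau> \<and>
                 \<not> closedin (prodiscrete_topology G A) (\<tau> ` configurations G A))) \<and>
         (\<forall>smul :: 'k::field \<Rightarrow> 'v::ab_group_add \<Rightarrow> 'v.
            vector_space smul \<and> infinite_dimensional smul \<longrightarrow>
            (\<exists>\<tau>. linear_cellular_automaton G smul \<tau> \<and>
                 \<not> closedin (prodiscrete_topology G (UNIV :: 'v set))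
                     (\<tau> ` configurations G (UNIV :: 'v set))))"
  by (intro conjI allI impI group.exists_automaton_image_not_closed[OF assms(1,3)]
      group.exists_linear_automaton_image_not_closed[OF assms(1,3)]) simp_all

end
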